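(* Let $I \supset [0,\infty)$ be an open interval and let $f : I \to (0,\infty)$ be differentiable. Let $a \in [0,\infty)$, $b \ge 1$, $a<b$, let $p,q>1$ with $\frac1p+\frac1q=1$, and let $m\in(0,1)$. Suppose that $f' \in L[a,b]$, that $|f'|^{q}$ is decreasing and $m$-geometrically convex on $[\min\{1,a\},b]$, and that $|f'(y)| \le M < 1$ for all $y \in [\min\{1,a\},b]$. Then for every $\mu>0$ and every $x \in [a,b]$, $$\left| \frac{(x-a)^{\mu}+(b-x)^{\mu}}{b-a} f(x) - \frac{\Gamma(\mu+1)}{b-a}\left[ J_{x^-}^{\mu} f(a) + J_{x^+}^{\mu} f(b) \right] \right| \le M^{m}\left(\frac{1}{p\mu+1}\right)^{\frac1p}\left(\frac{M^{q(1-m)}-1}{q(1-m)\ln M}\right)^{\frac1q}\left[ \frac{(x-a)^{\mu+1}+(b-x)^{\mu+1}}{b-a} \right].$$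
   Context: Let $m\in(0,1]$. A positive function $g$ is $m$-geometrically convex on an interval $J\subset[0,\infty)$ if $g\left(x^{t}y^{m(1-t)}\right) \le [g(x)]^{t}[g(y)]^{m(1-t)}$ for all $x,y\in J$ and $t\in[0,1]$. $L[a,b]$ denotes the Lebesgue integrable functions on $[a,b]$, and $\Gamma$ is the Gamma function. The Riemann-Liouville fractional integrals of order $\mu>0$ are $J_{c^+}^{\mu} f(x)=\frac{1}{\Gamma(\mu)}\int_c^x (x-t)^{\mu-1}f(t)\,dt$ for $x>c$ and $J_{d^-}^{\mu} f(x)=\frac{1}{\Gamma(\mu)}\int_x^d (t-x)^{\mu-1}f(t)\,dt$ for $x<d$. Thus $J_{x^-}^{\mu} f(a)=\frac{1}{\Gamma(\mu)}\int_a^x (t-a)^{\mu-1}f(t)\,dt$ and $J_{x^+}^{\mu} f(b)=\frac{1}{\Gamma(\mu)}\int_x^b (b-t)^{\mu-1}f(t)\,dt$ (each being $0$ when the integration interval is a point). *)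

theory Defs
  imports "HOL-Analysis.Analysis"
begin

text \<open>
  Real powers of a nonnegative base with the usual convention that the zeroth power of
  \<open>0\<close> is \<open>1\<close>; the library has \<open>0 powr 0 = 0\<close>. The two differ only there.
\<close>
definition rpow :: "real \<Rightarrow> real \<Rightarrow> real" where
  "rpow x t = (if t = 0 then 1 else x powr t)"

text \<open>
  The interval \<open>J\<close> may contain \<open>0\<close>, so the inner powers need \<^const>\<open>rpow\<close>; the values of
  \<open>g\<close> are positive, so the outer ones do not.
\<close>
definition m_geometrically_convex_on :: "real \<Rightarrow> real set \<Rightarrow> (real \<Rightarrow> real) \<Rightarrow> bool" where
  "m_geometrically_convex_on m J g \<longleftrightarrow>
     0 < m \<and> m \<le> 1 \<and> is_interval J \<and> J \<subseteq> {0..} \<and>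
     (\<forall>x\<in>J. 0 < g x) \<and>
     (\<forall>x\<in>J. \<forall>y\<in>J. \<forall>t\<in>{0..1}.
        g (rpow x t * rpow y (m * (1 - t))) \<le> g x powr t * g y powr (m * (1 - t)))"

text \<open>
  \<open>RL_plus \<mu> c f x\<close> is \<open>(J\<^sup>\<mu> f)(x)\<close> with base point \<open>c+\<close>, meant for \<open>c \<le> x\<close>, and
  \<open>RL_minus \<mu> d f x\<close> is \<open>(J\<^sup>\<mu> f)(x)\<close> with base point \<open>d-\<close>, meant for \<open>x \<le> d\<close>.
\<close>
definition RL_plus :: "real \<Rightarrow> real \<Rightarrow> (real \<Rightarrow> real) \<Rightarrow> real \<Rightarrow> real" where
  "RL_plus \<mu> c f x =
     1 / Gamma \<mu> * (LINT t:{c..x}|lebesgue. (x - t) powr (\<mu> - 1) * f t)"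

definition RL_minus :: "real \<Rightarrow> real \<Rightarrow> (real \<Rightarrow> real) \<Rightarrow> real \<Rightarrow> real" where
  "RL_minus \<mu> d f x =
     1 / Gamma \<mu> * (LINT t:{x..d}|lebesgue. (t - x) powr (\<mu> - 1) * f t)"

end

theory Submission
  imports Defs
begin

text \<open>
  Since \<open>0 < M < 1\<close>, the bound \<open>\<bar>f'\<bar> \<le> M\<close> is already stronger than the estimate
  \<open>\<bar>f'(s x + (1 - s) a)\<bar> \<le> M powr (s + m (1 - s))\<close> that monotonicity and convexity would give,
  so only the Lipschitz bound for \<open>f\<close> matters. From
  \<open>(x - a) powr \<mu> = \<mu> \<integral> (t - a) powr (\<mu> - 1) dt\<close> over \<open>[a, x]\<close>, the left half of the difference is
  \<open>\<mu> \<integral> (t - a) powr (\<mu> - 1) (f x - f t) dt\<close>, which is at most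
  \<open>M (x - a) powr (\<mu> + 1) / (\<mu> + 1)\<close>; the right half is its mirror image. It remains to compare
  \<open>M / (\<mu> + 1)\<close> with the stated constant, by Bernoulli's inequality and \<open>1 + v \<le> exp v\<close>.
\<close>

lemma has_integral_powr_from:
  fixes a x \<nu> :: real
  assumes "0 < \<nu>" "a \<le> x"
  shows "((\<lambda>t. (t - a) powr (\<nu> - 1)) has_integral (x - a) powr \<nu> / \<nu>) {a..x}"
proof -
  have "((\<lambda>t. (t - a) powr (\<nu> - 1)) has_integral
          ((x - a) powr \<nu> / \<nu> - (a - a) powr \<nu> / \<nu>)) {a..x}"
  \<comment> \<open>For \<open>\<nu> < 1\<close> the antiderivative has no finite derivative at
    \<open>a\<close>, so differentiability is asked only in the open interval, with continuity up to
    the ends.\<close>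
  proof (rule fundamental_theorem_of_calculus_interior[OF assms(2)])
    show "continuous_on {a..x} (\<lambda>t. (t - a) powr \<nu> / \<nu>)"
      using assms by (intro continuous_intros continuous_on_powr') auto
    fix t assume "t \<in> {a<..<x}"
    then have "((\<lambda>t. (t - a) powr \<nu> / \<nu>) has_real_derivative (t - a) powr (\<nu> - 1)) (at t)"
      using assms by (auto intro!: derivative_eq_intros)
    then show "((\<lambda>t. (t - a) powr \<nu> / \<nu>) has_vector_derivative (t - a) powr (\<nu> - 1)) (at t)"
      by (rule has_real_derivative_iff_has_vector_derivative[THEN iffD1])
  qed
  then show ?thesis by simp
qed

text \<open>The weight may be unbounded at \<open>a\<close> but is nonnegative and integrable; a
  continuous \<open>f\<close> is bounded and measurable on the compact interval.\<close>

lemma absolutely_integrable_powr_mult_continuous: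
  fixes f :: "real \<Rightarrow> real" and a x \<mu> :: real
  assumes "0 < \<mu>" "a \<le> x" and cont: "continuous_on {a..x} f"
  shows "(\<lambda>t. (t - a) powr (\<mu> - 1) * f t) absolutely_integrable_on {a..x}"
proof -
  have "(\<lambda>t. (t - a) powr (\<mu> - 1)) absolutely_integrable_on {a..x}"
    using has_integral_powr_from[OF assms(1,2)]
    by (intro nonnegative_absolutely_integrable_1) auto
  moreover have "f \<in> borel_measurable (lebesgue_on {a..x})"
    using cont by (simp add: continuous_imp_measurable_on_sets_lebesgue)
  moreover have "bounded (f ` {a..x})"
    using cont by (intro compact_imp_bounded compact_continuous_image) auto
  ultimately have "(\<lambda>t. f t * (t - a) powr (\<mu> - 1)) absolutely_integrable_on {a..x}"
    by (intro absolutely_integrable_bounded_measurable_product_real) auto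
  then show ?thesis by (simp add: mult.commute)
qed

lemma powr_weighted_integral_deviation:
  fixes f :: "real \<Rightarrow> real" and a x \<mu> M :: real
  assumes "0 < \<mu>" "a \<le> x" and cont: "continuous_on {a..x} f"
    and lip: "\<And>t. t \<in> {a..x} \<Longrightarrow> \<bar>f x - f t\<bar> \<le> M * (x - t)"
  shows "\<bar>(x - a) powr \<mu> * f x - \<mu> * (LINT t:{a..x}|lebesgue. (t - a) powr (\<mu> - 1) * f t)\<bar>
           \<le> M * (x - a) powr (\<mu> + 1) / (\<mu> + 1)"
proof -
  let ?w = "\<lambda>t. (t - a) powr (\<mu> - 1)"
  let ?R = "LINT t:{a..x}|lebesgue. ?w t * f t"
  note ai = absolutely_integrable_powr_mult_continuous[OF assms(1-3)]
  have "((\<lambda>t. ?w t * f t) has_integral ?R) {a..x}"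
    using ai by (metis has_integral_set_lebesgue)
  from has_integral_diff[OF has_integral_mult_left[OF has_integral_powr_from[OF assms(1,2)], of "f x"] this]
  have dev: "((\<lambda>t. ?w t * (f x - f t)) has_integral ((x - a) powr \<mu> / \<mu> * f x - ?R)) {a..x}"
    by (simp add: algebra_simps)
  \<comment> \<open>This majorant is \<open>M * ?w t * (x - t)\<close>, split by
    \<open>x - t = (x - a) - (t - a)\<close> into two power integrals with exponents
    \<open>\<mu>\<close> and \<open>\<mu> + 1\<close>.\<close>
  have "((\<lambda>t. M * ((x - a) * ?w t - (t - a) powr (\<mu> + 1 - 1))) has_integral
          M * ((x - a) * ((x - a) powr \<mu> / \<mu>) - (x - a) powr (\<mu> + 1) / (\<mu> + 1))) {a..x}"
    using assms(1,2)
    by (intro has_integral_mult_right has_integral_diff has_integral_powr_from) auto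
  moreover have "(x - a) * ((x - a) powr \<mu> / \<mu>) - (x - a) powr (\<mu> + 1) / (\<mu> + 1)
      = (x - a) powr (\<mu> + 1) / (\<mu> * (\<mu> + 1))"
    using assms(1,2) by (simp add: powr_add field_simps)
  ultimately have bound: "((\<lambda>t. M * ((x - a) * ?w t - (t - a) powr (\<mu> + 1 - 1))) has_integral
          M * ((x - a) powr (\<mu> + 1) / (\<mu> * (\<mu> + 1)))) {a..x}"
    by simp
  have "norm (integral {a..x} (\<lambda>t. ?w t * (f x - f t)))
      \<le> integral {a..x} (\<lambda>t. M * ((x - a) * ?w t - (t - a) powr (\<mu> + 1 - 1)))"
  proof (rule integral_norm_bound_integral)
    fix t assume t: "t \<in> {a..x}"
    \<comment> \<open>At \<open>t = a\<close> both sides vanish, since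
      \<open>0 powr \<mu> = 0\<close>.\<close>
    have "(t - a) powr \<mu> = (t - a) * ?w t"
      using t by (cases "t = a") (simp_all add: powr_mult_base)
    then have "(x - a) * ?w t - (t - a) powr (\<mu> + 1 - 1) = ?w t * (x - t)"
      by (simp add: algebra_simps)
    then show "norm (?w t * (f x - f t)) \<le> M * ((x - a) * ?w t - (t - a) powr (\<mu> + 1 - 1))"
      using mult_left_mono[OF lip[OF t], of "?w t"] by (simp add: abs_mult mult_ac)
  qed (use dev bound in blast)+
  then have "\<bar>(x - a) powr \<mu> / \<mu> * f x - ?R\<bar> \<le> M * ((x - a) powr (\<mu> + 1) / (\<mu> * (\<mu> + 1)))"
    by (simp only: integral_unique[OF dev] integral_unique[OF bound] real_norm_def)
  then have "\<mu> * \<bar>(x - a) powr \<mu> / \<mu> * f x - ?R\<bar>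
      \<le> \<mu> * (M * ((x - a) powr (\<mu> + 1) / (\<mu> * (\<mu> + 1))))"
    using assms(1) by (intro mult_left_mono) auto
  moreover have "\<mu> * \<bar>(x - a) powr \<mu> / \<mu> * f x - ?R\<bar> = \<bar>\<mu> * ((x - a) powr \<mu> / \<mu> * f x - ?R)\<bar>"
    using assms(1) by (simp add: abs_mult)
  moreover have "\<mu> * ((x - a) powr \<mu> / \<mu> * f x - ?R) = (x - a) powr \<mu> * f x - \<mu> * ?R"
    using assms(1) by (simp add: right_diff_distrib)
  moreover have "\<mu> * (M * ((x - a) powr (\<mu> + 1) / (\<mu> * (\<mu> + 1)))) = M * (x - a) powr (\<mu> + 1) / (\<mu> + 1)"
    using assms(1) by simp
  ultimately show ?thesis
    by (simp only:)
qed

text \<open>The substitution \<open>t \<mapsto> - t\<close> turns the weight into one singular at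
  the left endpoint \<open>- b\<close>, and the unreflected estimate applies to
  \<open>f (- t)\<close> on \<open>{-b..-x}\<close>.\<close>

lemma powr_weighted_integral_deviation_reflected:
  fixes f :: "real \<Rightarrow> real" and b x \<mu> M :: real
  assumes "0 < \<mu>" "x \<le> b" and cont: "continuous_on {x..b} f"
    and lip: "\<And>t. t \<in> {x..b} \<Longrightarrow> \<bar>f x - f t\<bar> \<le> M * (t - x)"
  shows "\<bar>(b - x) powr \<mu> * f x - \<mu> * (LINT t:{x..b}|lebesgue. (b - t) powr (\<mu> - 1) * f t)\<bar>
           \<le> M * (b - x) powr (\<mu> + 1) / (\<mu> + 1)"
proof -
  let ?g = "\<lambda>t. (b - t) powr (\<mu> - 1) * f t"
  have cont': "continuous_on {-b..-x} (\<lambda>t. f (- t))"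
    by (rule continuous_on_compose2[OF cont]) (auto intro!: continuous_intros)
  have ai: "(\<lambda>t. ?g (- t)) absolutely_integrable_on {-b..-x}"
    using absolutely_integrable_powr_mult_continuous[OF assms(1) _ cont'] assms(2)
    by (simp add: add.commute)
  then have "?g absolutely_integrable_on {x..b}"
    by (rule absolutely_integrable_reflect_real[where f = ?g, THEN iffD1])
  \<comment> \<open>The reflection rule is used for the gauge integral; absolute integrability on
    both sides lets it carry over to the Lebesgue integral.\<close>
  with ai have "(LINT t:{x..b}|lebesgue. ?g t) = (LINT t:{-b..-x}|lebesgue. ?g (- t))"
    using Henstock_Kurzweil_Integration.integral_reflect_real[where f = ?g and a = x and b = b]
    by (simp only: set_lebesgue_integral_eq_integral(2))
  moreover have "\<bar>f (- (- x)) - f (- t)\<bar> \<le> M * (- x - t)" if "t \<in> {-b..-x}" for t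
    using lip[of "- t"] that by (simp add: minus_diff_commute)
  note powr_weighted_integral_deviation[OF assms(1) _ cont' this]
  ultimately show ?thesis
    using assms(2) by (simp add: add.commute)
qed

text \<open>Bernoulli's inequality \<open>(p * \<mu> + 1) powr (1 / p) \<le> \<mu> + 1\<close> comes
  from weighted AM-GM for \<open>p * \<mu> + 1\<close> and \<open>1\<close>, with weights
  \<open>1 / p\<close> and \<open>1 - 1 / p\<close>; then take reciprocals.\<close>

lemma bernoulli_exponent_bound:
  fixes p \<mu> :: real
  assumes "1 < p" "0 < \<mu>"
  shows "1 / (\<mu> + 1) \<le> (1 / (p * \<mu> + 1)) powr (1 / p)"
proof -
  have "(p * \<mu> + 1) powr (1 / p) * 1 powr (1 - 1 / p) \<le> 1 / p * (p * \<mu> + 1) + (1 - 1 / p) * 1"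
    using assms by (intro Youngs_inequality_0) (auto intro: add_pos_pos)
  also have "\<dots> = \<mu> + 1"
    using assms by (simp add: field_simps)
  finally have "(p * \<mu> + 1) powr (1 / p) \<le> \<mu> + 1"
    by simp
  moreover have "0 < p * \<mu> + 1"
    using assms by (simp add: add_pos_pos)
  ultimately show ?thesis
    by (simp add: powr_divide frac_le)
qed

text \<open>The right side is the mean of the decreasing function \<open>M powr s\<close> over
  \<open>0 \<le> s \<le> c\<close>, hence at least its value at \<open>c\<close>. With
  \<open>M powr c = exp u\<close> this is \<open>1 - u \<le> exp (- u)\<close> times
  \<open>exp u\<close>; dividing by \<open>u < 0\<close> reverses the inequality.\<close>

lemma powr_le_log_mean:
  fixes M c :: real
  assumes "0 < M" "M < 1" "0 < c"
  shows "M powr c \<le> (M powr c - 1) / (c * ln M)"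
proof -
  define u where "u = c * ln M"
  have u: "u < 0" using assms by (simp add: u_def mult_pos_neg)
  have "(1 - u) * exp u \<le> exp (- u) * exp u"
    using exp_ge_add_one_self[of "- u"] by (intro mult_right_mono) auto
  then have "exp u - 1 \<le> exp u * u"
    by (simp add: algebra_simps flip: exp_add)
  moreover have "M powr c = exp u"
    using assms by (simp add: powr_def u_def)
  ultimately show ?thesis
    using u unfolding u_def[symmetric] by (simp add: neg_le_divide_eq)
qed

theorem corollary2:
  fixes I :: "real set" and f :: "real \<Rightarrow> real" and a b p q m M \<mu> x :: real
  assumes "open I" and "is_interval I" and "{0..} \<subseteq> I"
    and "\<And>y. y \<in> I \<Longrightarrow> 0 < f y"
    and "f differentiable_on I"
    and "0 \<le> a" and "1 \<le> b" and "a < b"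
    and "1 < p" and "1 < q" and "1 / p + 1 / q = 1"
    and "0 < m" and "m < 1"
    and "deriv f absolutely_integrable_on {a..b}"
    and "antimono_on {min 1 a..b} (\<lambda>y. \<bar>deriv f y\<bar> powr q)"
    and "m_geometrically_convex_on m {min 1 a..b} (\<lambda>y. \<bar>deriv f y\<bar> powr q)"
    and "\<And>y. y \<in> {min 1 a..b} \<Longrightarrow> \<bar>deriv f y\<bar> \<le> M" and "M < 1"
    and "0 < \<mu>" and "x \<in> {a..b}"
  shows "\<bar>((x - a) powr \<mu> + (b - x) powr \<mu>) / (b - a) * f x
            - Gamma (\<mu> + 1) / (b - a) * (RL_minus \<mu> x f a + RL_plus \<mu> x f b)\<bar>
         \<le> M powr m * (1 / (p * \<mu> + 1)) powr (1 / p)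
             * ((M powr (q * (1 - m)) - 1) / (q * (1 - m) * ln M)) powr (1 / q)
             * (((x - a) powr (\<mu> + 1) + (b - x) powr (\<mu> + 1)) / (b - a))"
proof -
  define C where "C = M powr m * (1 / (p * \<mu> + 1)) powr (1 / p)
             * ((M powr (q * (1 - m)) - 1) / (q * (1 - m) * ln M)) powr (1 / q)"
  \<comment> \<open>\<open>A\<close> and \<open>B\<close> are the left and right halves:
    \<open>(A + B) / (b - a)\<close> is the quantity to be bounded.\<close>
  define A where "A = (x - a) powr \<mu> * f x
    - \<mu> * (LINT t:{a..x}|lebesgue. (t - a) powr (\<mu> - 1) * f t)"
  define B where "B = (b - x) powr \<mu> * f x
    - \<mu> * (LINT t:{x..b}|lebesgue. (b - t) powr (\<mu> - 1) * f t)"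
  have x: "a \<le> x" "x \<le> b" using assms(20) by auto
  \<comment> \<open>Geometric convexity includes positivity of the function, so
    \<open>deriv f b\<close> is nonzero and \<open>M\<close> is positive, as the powers and the
    logarithm of \<open>M\<close> require.\<close>
  have "0 < \<bar>deriv f b\<bar> powr q"
    using assms(8,16) by (auto simp: m_geometrically_convex_on_def)
  then have "0 < \<bar>deriv f b\<bar>" by simp
  also have "\<dots> \<le> M" using assms(8) by (intro assms(17)) auto
  finally have M: "0 < M" .

  have deriv: "(f has_real_derivative deriv f y) (at y)" if "y \<in> {a..b}" for y
  proof -
    have "y \<in> I" using that assms(3,6) by auto
    then have "f differentiable at y"
      using assms(1,5) by (simp add: differentiable_on_eq_differentiable_at)
    then show ?thesis
      by (simp add: DERIV_deriv_iff_real_differentiable)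
  qed
  then have cont: "continuous_on {a..b} f"
    by (meson DERIV_continuous_on DERIV_subset subset_UNIV)
  have lip: "\<bar>f y - f z\<bar> \<le> M * \<bar>y - z\<bar>" if "y \<in> {a..b}" "z \<in> {a..b}" for y z
  proof -
    have "norm (f y - f z) \<le> M * norm (y - z)"
    proof (rule field_differentiable_bound[of "{a..b}"])
      fix w assume w: "w \<in> {a..b}"
      show "(f has_field_derivative deriv f w) (at w within {a..b})"
        using deriv[OF w] by (rule DERIV_subset) simp
      show "norm (deriv f w) \<le> M" using assms(17)[of w] w by auto
    qed (use that in auto)
    then show ?thesis by simp
  qed
  have "\<bar>A\<bar> \<le> M * (x - a) powr (\<mu> + 1) / (\<mu> + 1)"
    unfolding A_def
  proof (rule powr_weighted_integral_deviation)
    show "continuous_on {a..x} f" using cont x by (auto elim: continuous_on_subset)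
    show "\<bar>f x - f t\<bar> \<le> M * (x - t)" if "t \<in> {a..x}" for t
      using lip[of x t] that x by simp
  qed (use assms(19) x in auto)
  moreover have "\<bar>B\<bar> \<le> M * (b - x) powr (\<mu> + 1) / (\<mu> + 1)"
    unfolding B_def
  proof (rule powr_weighted_integral_deviation_reflected)
    show "continuous_on {x..b} f" using cont x by (auto elim: continuous_on_subset)
    show "\<bar>f x - f t\<bar> \<le> M * (t - x)" if "t \<in> {x..b}" for t
      using lip[of x t] that x by simp
  qed (use assms(19) x in auto)
  ultimately have "\<bar>A + B\<bar> \<le> M * (1 / (\<mu> + 1)) * ((x - a) powr (\<mu> + 1) + (b - x) powr (\<mu> + 1))"
    by (simp add: add_divide_distrib distrib_left)
  also have "M * (1 / (\<mu> + 1)) \<le> C"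
  proof -
    \<comment> \<open>Since \<open>q * (1 - m) / q = 1 - m\<close>, this is
      \<open>M = M powr m * M powr (1 - m)\<close>, written so that the logarithmic mean bound
      applies under the outer power \<open>1 / q\<close>.\<close>
    have "M = M powr m * (M powr (q * (1 - m))) powr (1 / q)"
      using M assms(10) by (simp add: powr_powr flip: powr_add)
    also have "\<dots> \<le> M powr m * ((M powr (q * (1 - m)) - 1) / (q * (1 - m) * ln M)) powr (1 / q)"
      using powr_le_log_mean[OF M assms(18), of "q * (1 - m)"] assms(10,13)
      by (intro mult_left_mono powr_mono2) auto
    finally have "M * (1 / (\<mu> + 1)) \<le>
        (M powr m * ((M powr (q * (1 - m)) - 1) / (q * (1 - m) * ln M)) powr (1 / q))
        * (1 / (p * \<mu> + 1)) powr (1 / p)"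
      using bernoulli_exponent_bound[OF assms(9,19)] assms(19) by (intro mult_mono) auto
    then show ?thesis by (simp add: C_def mult_ac)
  qed
  finally have "\<bar>A + B\<bar> \<le> C * ((x - a) powr (\<mu> + 1) + (b - x) powr (\<mu> + 1))"
    by (simp add: mult_right_mono)
  then have "\<bar>A + B\<bar> / (b - a) \<le> C * ((x - a) powr (\<mu> + 1) + (b - x) powr (\<mu> + 1)) / (b - a)"
    using assms(8) by (intro divide_right_mono) auto
  moreover have "((x - a) powr \<mu> + (b - x) powr \<mu>) / (b - a) * f x
            - Gamma (\<mu> + 1) / (b - a) * (RL_minus \<mu> x f a + RL_plus \<mu> x f b) = (A + B) / (b - a)"
  proof -
    \<comment> \<open>The functional equation cancels the factor \<open>1 / Gamma \<mu>\<close> of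
      the fractional integrals and leaves the factor \<open>\<mu>\<close> of \<open>A\<close> and
      \<open>B\<close>.\<close>
    have "Gamma (\<mu> + 1) = \<mu> * Gamma \<mu>"
      using assms(19) by (intro Gamma_plus1) (auto elim: nonpos_Ints_cases)
    moreover have "Gamma \<mu> \<noteq> 0" using Gamma_real_pos[OF assms(19)] by simp
    ultimately have "Gamma (\<mu> + 1) * (RL_minus \<mu> x f a + RL_plus \<mu> x f b)
        = \<mu> * (LINT t:{a..x}|lebesgue. (t - a) powr (\<mu> - 1) * f t)
        + \<mu> * (LINT t:{x..b}|lebesgue. (b - t) powr (\<mu> - 1) * f t)"
      by (simp add: RL_minus_def RL_plus_def distrib_left)
    then have "A + B = ((x - a) powr \<mu> + (b - x) powr \<mu>) * f x
        - Gamma (\<mu> + 1) * (RL_minus \<mu> x f a + RL_plus \<mu> x f b)"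
      by (simp add: A_def B_def algebra_simps)
    then show ?thesis by (simp add: diff_divide_distrib)
  qed
  ultimately show ?thesis
    using assms(8) by (simp add: C_def)
qed

end
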